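(* Let $\mathcal{X}$ be a compact and convex subset of $\mathbb{R}^d$ with nonempty interior, and let $\beta>0$. For $\mathbf{x}\in\mathcal{X}$ and a finite set $\mathbf{Z}\subset\mathcal{X}$, define $$D_\beta(\mathbf{x},\mathbf{Z})=\min\{d(\mathbf{x},\mathbf{Z}),\ \beta\, d(\mathbf{x},\partial\mathcal{X})\},$$ where $d(\mathbf{x},\mathbf{Z})=\min_{\mathbf{z}\in\mathbf{Z}}\|\mathbf{x}-\mathbf{z}\|$ (Euclidean norm), with the convention $d(\mathbf{x},\emptyset)=+\infty$, and $d(\mathbf{x},\partial\mathcal{X})=\inf_{\mathbf{z}\in\partial\mathcal{X}}\|\mathbf{x}-\mathbf{z}\|$. For an $n$-point design $\mathbf{Z}_n=\{\mathbf{z}_1,\ldots,\mathbf{z}_n\}\subset\mathcal{X}$ define the $\beta$-spacing $$S_\beta(\mathbf{Z}_n)=\sup_{\mathbf{x}\in\mathcal{X}} D_\beta(\mathbf{x},\mathbf{Z}_n)\quad(n\ge 1),$$ and, for $n\geq 2$, $$P_\beta(\mathbf{Z}_n)=\min_{\mathbf{z}_i\neq\mathbf{z}_j\in\mathbf{Z}_n}\tfrac12\min\{\|\mathbf{z}_i-\mathbf{z}_j\|,\ \beta\, d(\mathbf{z}_i,\partial\mathcal{X})\},\qquad \rho_\beta(\mathbf{Z}_n)=\frac{S_\beta(\mathbf{Z}_n)}{P_\beta(\mathbf{Z}_n)}.$$ Let $S^\star_{\beta,n}=\min_{\mathbf{Z}_n\subset\mathcal{X}} S_\beta(\mathbf{Z}_n)$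 and $P^\star_{\beta,n}=\max_{\mathbf{Z}_n\subset\mathcal{X}}P_\beta(\mathbf{Z}_n)$, the optimum being over $n$-point designs in $\mathcal{X}$. Let $\mathbf{X}_n=\{\mathbf{x}_1,\ldots,\mathbf{x}_n\}$ be constructed greedily by $\mathbf{X}_0=\emptyset$ and $\mathbf{x}_{k+1}\in\arg\max_{\mathbf{x}\in\mathcal{X}} D_\beta(\mathbf{x},\mathbf{X}_k)$, $\mathbf{X}_{k+1}=\mathbf{X}_k\cup\{\mathbf{x}_{k+1}\}$, for $k=0,1,\ldots$. Then $P_\beta(\mathbf{X}_{n+1})=\tfrac12 S_\beta(\mathbf{X}_n)$ for all $n\ge1$, and $$\frac12\le \frac{S^\star_{\beta,n}}{S_\beta(\mathbf{X}_n)}\le 1\ \ (n\ge 1),\qquad \frac12\le\frac{P_\beta(\mathbf{X}_n)}{P^\star_{\beta,n}}\le 1,\quad 1\le\rho_\beta(\mathbf{X}_n)\le 2\ \ (n\ge2).$$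
   Context: A design is a finite set of points of $\mathcal{X}$; $\partial\mathcal{X}$ denotes the boundary of $\mathcal{X}$ and all distances are Euclidean. *)

theory Defs
  imports "HOL-Analysis.Analysis"
begin

definition designs :: "(real^'d) set \<Rightarrow> nat \<Rightarrow> (real^'d) set set" where
  "designs X n = {Z. Z \<subseteq> X \<and> finite Z \<and> card Z = n}"

text \<open>Extended-real valued, because of the convention $d(x,\emptyset) = +\infty$.
  Only meaningful for finite \<open>Z\<close>.\<close>

definition dist_design :: "real^'d \<Rightarrow> (real^'d) set \<Rightarrow> ereal" where
  "dist_design x Z = (if Z = {} then \<infinity> else ereal (Min ((\<lambda>z. norm (x - z)) ` Z)))"

definition dist_boundary :: "(real^'d) set \<Rightarrow> real^'d \<Rightarrow> real" where
  "dist_boundary X x = infdist x (frontier X)"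

text \<open>The minimum is at most the finite second argument, so \<open>real_of_ereal\<close> loses nothing.\<close>

definition D_beta :: "real \<Rightarrow> (real^'d) set \<Rightarrow> real^'d \<Rightarrow> (real^'d) set \<Rightarrow> real" where
  "D_beta \<beta> X x Z = real_of_ereal (min (dist_design x Z) (ereal (\<beta> * dist_boundary X x)))"

definition S_beta :: "real \<Rightarrow> (real^'d) set \<Rightarrow> (real^'d) set \<Rightarrow> real" where
  "S_beta \<beta> X Z = (SUP x\<in>X. D_beta \<beta> X x Z)"

definition P_beta :: "real \<Rightarrow> (real^'d) set \<Rightarrow> (real^'d) set \<Rightarrow> real" where
  "P_beta \<beta> X Z =
     Min {1/2 * min (norm (z - w)) (\<beta> * dist_boundary X z) | z w. z \<in> Z \<and> w \<in> Z \<and> z \<noteq> w}"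

definition rho_beta :: "real \<Rightarrow> (real^'d) set \<Rightarrow> (real^'d) set \<Rightarrow> real" where
  "rho_beta \<beta> X Z = S_beta \<beta> X Z / P_beta \<beta> X Z"

text \<open>\<open>LEAST\<close> and \<open>GREATEST\<close>, unlike \<open>Inf\<close> and \<open>Sup\<close>, denote an attained minimum and maximum.\<close>

definition S_star :: "real \<Rightarrow> (real^'d) set \<Rightarrow> nat \<Rightarrow> real" where
  "S_star \<beta> X n = (LEAST s. s \<in> S_beta \<beta> X ` designs X n)"

definition P_star :: "real \<Rightarrow> (real^'d) set \<Rightarrow> nat \<Rightarrow> real" where
  "P_star \<beta> X n = (GREATEST p. p \<in> P_beta \<beta> X ` designs X n)"

text \<open>A sequence \<open>x 1, x 2, \<dots>\<close> (the value \<open>x 0\<close> is unused); the \<open>k\<close>-point design is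
  \<open>x ` {1..k}\<close>, which is empty for \<open>k = 0\<close>.\<close>

definition greedy_seq :: "real \<Rightarrow> (real^'d) set \<Rightarrow> (nat \<Rightarrow> real^'d) \<Rightarrow> bool" where
  "greedy_seq \<beta> X x \<longleftrightarrow>
     (\<forall>k. is_arg_max (\<lambda>y. D_beta \<beta> X y (x ` {1..k})) (\<lambda>y. y \<in> X) (x (k + 1)))"

end

theory Submission
  imports Defs
begin

text \<open>
  A pigeonhole argument shows that \<open>P_beta \<beta> X Y \<le> S_beta \<beta> X Z\<close> whenever \<open>Y\<close> has more
  points than \<open>Z\<close>: if every point of \<open>Y\<close> is within \<open>s\<close> of \<open>Z\<close>, two points of \<open>Y\<close> share a
  neighbour in \<open>Z\<close> and are within \<open>2 * s\<close> of each other. For the greedy sequence,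
  \<open>P_beta \<beta> X (x ` {1..n+1}) = S_beta \<beta> X (x ` {1..n}) / 2\<close>, because the spacing decreases
  and each new point realises it. Taking \<open>Y\<close> or \<open>Z\<close> to be a greedy design and the other one
  arbitrary gives the two efficiency bounds. The lower bound on the mesh ratio uses that the
  distance to the boundary is concave on \<open>X\<close>: moving from one design point towards another
  by the distance \<open>P_beta \<beta> X Z\<close> yields a point at which \<open>D_beta\<close> is at least \<open>P_beta \<beta> X Z\<close>.
\<close>

section \<open>Pointwise characterisations and monotonicity of \<open>D_beta\<close>,
  \<open>S_beta\<close> and \<open>P_beta\<close>\<close>

lemma le_D_beta_iff:
  assumes "finite Z"
  shows "r \<le> D_beta \<beta> X x Z \<longleftrightarrow>
    (\<forall>z\<in>Z. r \<le> norm (x - z)) \<and> r \<le> \<beta> * dist_boundary X x"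
proof (cases "Z = {}")
  case True
  then show ?thesis by (simp add: D_beta_def dist_design_def)
next
  case False
  then have "D_beta \<beta> X x Z = min (Min ((\<lambda>z. norm (x - z)) ` Z)) (\<beta> * dist_boundary X x)"
    by (simp add: D_beta_def dist_design_def min_def)
  then show ?thesis using assms False by simp
qed

lemma D_beta_le_iff:
  assumes "finite Z"
  shows "D_beta \<beta> X x Z \<le> r \<longleftrightarrow>
    (\<exists>z\<in>Z. norm (x - z) \<le> r) \<or> \<beta> * dist_boundary X x \<le> r"
proof (cases "Z = {}")
  case True
  then show ?thesis by (simp add: D_beta_def dist_design_def)
next
  case False
  then have "D_beta \<beta> X x Z = min (Min ((\<lambda>z. norm (x - z)) ` Z)) (\<beta> * dist_boundary X x)"
    by (simp add: D_beta_def dist_design_def min_def)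
  then show ?thesis using assms False by (simp add: min_le_iff_disj Min_le_iff)
qed

lemma D_beta_nonneg:
  assumes "finite Z" "\<beta> \<ge> 0"
  shows "0 \<le> D_beta \<beta> X x Z"
  using assms by (simp add: le_D_beta_iff dist_boundary_def infdist_nonneg)

lemma D_beta_antimono:
  assumes "finite W" "Z \<subseteq> W"
  shows "D_beta \<beta> X x W \<le> D_beta \<beta> X x Z"
proof -
  have "finite Z" using assms finite_subset by blast
  then show ?thesis
    using assms le_D_beta_iff[of Z] le_D_beta_iff[of W "D_beta \<beta> X x W" \<beta> X x] by blast
qed

text \<open>The boundary term is continuous on the compact set \<open>X\<close> and alone bounds
  \<open>D_beta\<close>, so the empty design is covered too. This gives the real-valued
  \<open>SUP\<close> in \<open>S_beta\<close> its intended meaning.\<close>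

lemma bdd_above_D_beta:
  assumes "compact X" "finite Z"
  shows "bdd_above ((\<lambda>x. D_beta \<beta> X x Z) ` X)"
proof -
  have "compact ((\<lambda>x. \<beta> * dist_boundary X x) ` X)"
    unfolding dist_boundary_def
    by (intro compact_continuous_image continuous_intros assms)
  then have "bdd_above ((\<lambda>x. \<beta> * dist_boundary X x) ` X)"
    by (intro bounded_imp_bdd_above compact_imp_bounded)
  then obtain M where "\<forall>x\<in>X. \<beta> * dist_boundary X x \<le> M"
    by (auto simp: bdd_above_def)
  then show ?thesis
    using assms(2) by (intro bdd_aboveI[of _ M]) (auto simp: D_beta_le_iff)
qed

lemma D_beta_le_S_beta:
  assumes "compact X" "finite Z" "x \<in> X"
  shows "D_beta \<beta> X x Z \<le> S_beta \<beta> X Z"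
  unfolding S_beta_def by (rule cSUP_upper[OF assms(3) bdd_above_D_beta[OF assms(1,2)]])

lemma S_beta_le_iff:
  assumes "compact X" "finite Z" "X \<noteq> {}"
  shows "S_beta \<beta> X Z \<le> r \<longleftrightarrow> (\<forall>x\<in>X. D_beta \<beta> X x Z \<le> r)"
  unfolding S_beta_def by (rule cSUP_le_iff[OF assms(3) bdd_above_D_beta[OF assms(1,2)]])

lemma S_beta_antimono:
  assumes "compact X" "X \<noteq> {}" "finite W" "Z \<subseteq> W"
  shows "S_beta \<beta> X W \<le> S_beta \<beta> X Z"
proof -
  have "finite Z" using assms finite_subset by blast
  then have "D_beta \<beta> X x W \<le> S_beta \<beta> X Z" if "x \<in> X" for x
    using D_beta_antimono[OF assms(3,4)] D_beta_le_S_beta[OF assms(1) _ that] order_trans by blast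
  then show ?thesis using assms by (simp add: S_beta_le_iff)
qed

text \<open>With at least two points every \<open>z\<close> has a partner \<open>w\<close>, so the
  boundary condition decouples from the pair and concerns \<open>z\<close> alone.\<close>

lemma le_P_beta_iff:
  assumes "finite Z" "card Z \<ge> 2"
  shows "r \<le> P_beta \<beta> X Z \<longleftrightarrow> (\<forall>z\<in>Z. \<forall>w\<in>Z. z \<noteq> w \<longrightarrow> 2 * r \<le> norm (z - w)) \<and>
    (\<forall>z\<in>Z. 2 * r \<le> \<beta> * dist_boundary X z)"
proof -
  let ?f = "\<lambda>(z, w). 1/2 * min (norm (z - w)) (\<beta> * dist_boundary X z)"
  let ?I = "{p \<in> Z \<times> Z. fst p \<noteq> snd p}"
  have P: "P_beta \<beta> X Z = Min (?f ` ?I)"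
    unfolding P_beta_def by (rule arg_cong[of _ _ Min]) (force simp: image_iff)
  have other: "\<exists>w\<in>Z. w \<noteq> z" for z
  proof (rule ccontr)
    assume "\<not> (\<exists>w\<in>Z. w \<noteq> z)"
    then have "Z \<subseteq> {z}" by blast
    then have "card Z \<le> 1" using card_mono[of "{z}" Z] by simp
    then show False using assms by simp
  qed
  obtain a where "a \<in> Z" using assms by fastforce
  moreover obtain b where "b \<in> Z" "b \<noteq> a" using other by blast
  ultimately have "(a, b) \<in> ?I" by simp
  then have ne: "?I \<noteq> {}" by blast
  have fin: "finite ?I" using assms by simp
  have "r \<le> P_beta \<beta> X Z \<longleftrightarrow> (\<forall>p\<in>?I. r \<le> ?f p)"
    unfolding P using fin ne by (subst Min_ge_iff) auto
  also have "\<dots> \<longleftrightarrow> (\<forall>z\<in>Z. \<forall>w\<in>Z. z \<noteq> w \<longrightarrow>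
      2 * r \<le> norm (z - w) \<and> 2 * r \<le> \<beta> * dist_boundary X z)"
    unfolding Ball_def by (auto simp: field_simps)
  also have "\<dots> \<longleftrightarrow> (\<forall>z\<in>Z. \<forall>w\<in>Z. z \<noteq> w \<longrightarrow> 2 * r \<le> norm (z - w)) \<and>
    (\<forall>z\<in>Z. 2 * r \<le> \<beta> * dist_boundary X z)"
    using other by metis
  finally show ?thesis .
qed

section \<open>Pigeonhole comparison of two designs\<close>

lemma P_beta_le_S_beta_if_card_less:
  assumes "compact X" "\<beta> \<ge> 0" "Y \<subseteq> X" "finite Y" "finite Z" "Z \<noteq> {}" "card Z < card Y"
  shows "P_beta \<beta> X Y \<le> S_beta \<beta> X Z"
proof (rule ccontr)
  let ?s = "S_beta \<beta> X Z"
  assume "\<not> P_beta \<beta> X Y \<le> ?s"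
  then have less: "?s < P_beta \<beta> X Y" by simp
  have "card Z > 0" using assms by (simp add: card_gt_0_iff)
  then have card: "card Y \<ge> 2" using assms by linarith
  then obtain y\<^sub>0 where "y\<^sub>0 \<in> Y" by fastforce
  then have "0 \<le> ?s"
    using D_beta_nonneg[of Z \<beta> X y\<^sub>0] D_beta_le_S_beta[of X Z y\<^sub>0 \<beta>] assms by auto
  have sep: "\<forall>z\<in>Y. \<forall>w\<in>Y. z \<noteq> w \<longrightarrow> 2 * P_beta \<beta> X Y \<le> norm (z - w)"
    and bd: "\<forall>z\<in>Y. 2 * P_beta \<beta> X Y \<le> \<beta> * dist_boundary X z"
    using le_P_beta_iff[OF assms(4) card, of "P_beta \<beta> X Y" \<beta> X] by auto
  have "\<exists>z\<in>Z. norm (y - z) \<le> ?s" if "y \<in> Y" for y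
  proof -
    have "D_beta \<beta> X y Z \<le> ?s" using D_beta_le_S_beta assms that by blast
    \<comment> \<open>The boundary term at \<open>y\<close> is at least twice \<open>P_beta\<close>,
      hence above the nonnegative \<open>?s\<close>. So it is a point of \<open>Z\<close> that keeps
      \<open>D_beta\<close> small.\<close>
    moreover have "\<not> \<beta> * dist_boundary X y \<le> ?s" using bd that less \<open>0 \<le> ?s\<close> by fastforce
    ultimately show ?thesis using assms(5) by (simp add: D_beta_le_iff)
  qed
  then obtain g where g: "\<And>y. y \<in> Y \<Longrightarrow> g y \<in> Z" "\<And>y. y \<in> Y \<Longrightarrow> norm (y - g y) \<le> ?s"
    by metis
  have "card (g ` Y) < card Y"
    using card_mono[OF assms(5), of "g ` Y"] g(1) assms(7) by (simp add: image_subset_iff)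
  then obtain y w where yw: "y \<in> Y" "w \<in> Y" "y \<noteq> w" "g y = g w"
    using pigeonhole[of g Y] by (auto simp: inj_on_def)
  have "norm (y - w) \<le> norm (y - g y) + norm (w - g w)"
    using norm_triangle_ineq4[of "y - g y" "w - g w"] yw(4) by simp
  also have "\<dots> \<le> 2 * ?s" using g(2)[OF yw(1)] g(2)[OF yw(2)] by simp
  also have "\<dots> < 2 * P_beta \<beta> X Y" using less by simp
  finally show False using sep yw by force
qed

section \<open>Distance to the boundary and the mesh ratio\<close>

text \<open>A ball centred in \<open>X\<close> that leaves \<open>X\<close> is connected and so
  meets the frontier; an open ball inside \<open>X\<close> lies in the interior and so avoids
  it.\<close>

lemma le_dist_boundary_iff:
  assumes "compact X" "x \<in> X"
  shows "r \<le> dist_boundary X x \<longleftrightarrow> ball x r \<subseteq> X"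
proof
  assume r: "r \<le> dist_boundary X x"
  show "ball x r \<subseteq> X"
  proof (rule ccontr)
    assume "\<not> ball x r \<subseteq> X"
    then have "r > 0" and "ball x r - X \<noteq> {}"
      by (auto simp: dist_commute intro: le_less_trans[OF zero_le_dist])
    moreover from \<open>r > 0\<close> have "x \<in> ball x r \<inter> X" using assms(2) by simp
    ultimately obtain b where "b \<in> ball x r" "b \<in> frontier X"
      using connected_Int_frontier[of "ball x r" X] by fastforce
    then show False
      using r infdist_le[of b "frontier X" x] by (simp add: dist_boundary_def)
  qed
next
  assume b: "ball x r \<subseteq> X"
  \<comment> \<open>\<open>infdist\<close> to the empty set is 0 by convention, so the frontier has
    to be shown nonempty.\<close>
  have "X \<noteq> UNIV" using assms(1) not_compact_UNIV by metis
  then have ne: "frontier X \<noteq> {}" using assms(2) frontier_eq_empty by blast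
  have "ball x r \<subseteq> interior X" using b by (simp add: interior_maximal)
  then have "r \<le> dist x a" if "a \<in> frontier X" for a
    using that unfolding frontier_def by (meson DiffD2 mem_ball not_le subsetD)
  then show "r \<le> dist_boundary X x"
    unfolding dist_boundary_def infdist_def using ne by (auto intro: cINF_greatest)
qed

text \<open>Each point of the ball around the convex combination is the same combination of two
  translates, one in the ball around \<open>a\<close> and one in the ball around \<open>b\<close>.
  This is concavity in the form of convex superlevel sets.\<close>

lemma dist_boundary_segment:
  assumes "compact X" "convex X" "a \<in> X" "b \<in> X" "r \<le> dist_boundary X a"
    "r \<le> dist_boundary X b" "0 \<le> t" "t \<le> 1"
  shows "r \<le> dist_boundary X ((1 - t) *\<^sub>R a + t *\<^sub>R b)"
proof -
  let ?m = "(1 - t) *\<^sub>R a + t *\<^sub>R b"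
  have m: "?m \<in> X" using assms by (intro convexD) auto
  have "y \<in> X" if "y \<in> ball ?m r" for y
  proof -
    have "a + (y - ?m) \<in> ball a r" "b + (y - ?m) \<in> ball b r"
      using that by (auto simp: dist_norm norm_minus_commute)
    then have "a + (y - ?m) \<in> X" "b + (y - ?m) \<in> X"
      using assms le_dist_boundary_iff by blast+
    then have "(1 - t) *\<^sub>R (a + (y - ?m)) + t *\<^sub>R (b + (y - ?m)) \<in> X"
      using assms by (intro convexD) auto
    moreover have "(1 - t) *\<^sub>R (a + (y - ?m)) + t *\<^sub>R (b + (y - ?m)) = y"
      by (simp add: algebra_simps)
    ultimately show ?thesis by simp
  qed
  then show ?thesis using le_dist_boundary_iff[OF assms(1) m] by blast
qed

lemma P_beta_le_S_beta:
  assumes "compact X" "convex X" "\<beta> > 0" "Z \<subseteq> X" "finite Z" "card Z \<ge> 2"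
    and pos: "P_beta \<beta> X Z > 0"
  shows "P_beta \<beta> X Z \<le> S_beta \<beta> X Z"
proof -
  let ?p = "P_beta \<beta> X Z"
  have sep: "\<And>z w. z \<in> Z \<Longrightarrow> w \<in> Z \<Longrightarrow> z \<noteq> w \<Longrightarrow> 2 * ?p \<le> norm (z - w)"
    and bd: "\<And>z. z \<in> Z \<Longrightarrow> 2 * ?p \<le> \<beta> * dist_boundary X z"
    using le_P_beta_iff[OF assms(5,6), of ?p \<beta> X] by auto
  obtain a b where ab: "a \<in> Z" "b \<in> Z" "a \<noteq> b"
    using assms(6) card_le_Suc0_iff_eq[OF assms(5)] by fastforce
  \<comment> \<open>Chosen so that \<open>m\<close> lies at distance exactly \<open>?p\<close> from
    \<open>a\<close>. Every other design point is at least \<open>2 * ?p\<close> from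
    \<open>a\<close>, hence at least \<open>?p\<close> from \<open>m\<close>.\<close>
  define t where "t = ?p / norm (b - a)"
  define m where "m = (1 - t) *\<^sub>R a + t *\<^sub>R b"
  have nab: "2 * ?p \<le> norm (b - a)" using sep ab by metis
  then have "0 < norm (b - a)" using pos by linarith
  then have t: "0 \<le> t" "t \<le> 1" using nab pos by (simp_all add: t_def)
  have "m - a = t *\<^sub>R (b - a)" by (simp add: m_def algebra_simps)
  then have ma: "norm (m - a) = ?p" using pos ab by (simp add: t_def)
  have "2 * ?p / \<beta> \<le> dist_boundary X m"
    unfolding m_def using assms bd ab t
    by (intro dist_boundary_segment) (auto simp: field_simps)
  then have "?p \<le> \<beta> * dist_boundary X m"
    using assms(3) pos by (simp add: field_simps)
  moreover have "?p \<le> norm (m - z)" if "z \<in> Z" for z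
  proof (cases "z = a")
    case False
    then show ?thesis
      using sep[OF ab(1) that] ma norm_triangle_ineq4[of "m - z" "m - a"] by auto
  qed (simp add: ma)
  ultimately have "?p \<le> D_beta \<beta> X m Z" using assms(5) by (simp add: le_D_beta_iff)
  moreover have "m \<in> X" unfolding m_def using assms ab t by (intro convexD) auto
  ultimately show ?thesis using D_beta_le_S_beta[OF assms(1,5)] order_trans by blast
qed

text \<open>The interior is infinite, so it contains a point outside \<open>Z\<close>, where both
  terms of \<open>D_beta\<close> are positive. This later makes greedy points distinct and
  denominators positive.\<close>

lemma S_beta_pos:
  assumes "compact X" "interior X \<noteq> {}" "\<beta> > 0" "finite Z"
  shows "0 < S_beta \<beta> X Z"
proof -
  have "infinite (interior X)"
    using assms(2) empty_interior_finite[of "interior X"] by auto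
  then obtain x where x: "x \<in> interior X" "x \<notin> Z"
    using assms(4) by (meson finite_subset subsetI)
  then have xX: "x \<in> X" using interior_subset by blast
  obtain e where "e > 0" "ball x e \<subseteq> X" using x(1) mem_interior by blast
  then have "dist_boundary X x > 0"
    using le_dist_boundary_iff[OF assms(1) xX, of e] by linarith
  then have "0 < D_beta \<beta> X x Z"
    using D_beta_le_iff[OF assms(4), of \<beta> X x 0] x(2) assms(3)
    by (auto simp: not_le[symmetric] mult_le_0_iff)
  then show ?thesis using D_beta_le_S_beta[OF assms(1,4) xX, of \<beta>] by linarith
qed

section \<open>Existence of optimal designs by compactness\<close>

text \<open>Tychonoff's theorem. Designs will be encoded as functions on all of \<open>nat\<close>
  of which only the first \<open>n\<close> values count, so one compact space serves every
  \<open>n\<close>.\<close>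

lemma compact_tuples:
  assumes "compact X"
  shows "compact {z :: 'i \<Rightarrow> 'a::topological_space. \<forall>i. z i \<in> X}"
proof -
  have "compactin (product_topology (\<lambda>i::'i. euclidean) UNIV) (PiE UNIV (\<lambda>i. X))"
    using assms by (simp add: compactin_PiE)
  moreover have "PiE UNIV (\<lambda>i::'i. X) = {z. \<forall>i. z i \<in> X}" by auto
  ultimately show ?thesis by (simp add: euclidean_product_topology)
qed

text \<open>Applied with sublevel sets \<open>G v\<close> and the attained values \<open>V\<close>,
  the common point is a minimiser. Nestedness reduces the finite intersection property to the
  smallest index.\<close>

lemma compact_Inter_nested:
  fixes V :: "'v::linorder set"
  assumes "compact K" "\<And>v. closed (G v)" "\<And>v. v \<in> V \<Longrightarrow> K \<inter> G v \<noteq> {}"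
    and "V \<noteq> {}" "\<And>v w. v \<le> w \<Longrightarrow> G v \<subseteq> G w"
  obtains z where "z \<in> K" "\<And>v. v \<in> V \<Longrightarrow> z \<in> G v"
proof -
  have "K \<inter> (\<Inter>v\<in>V. G v) \<noteq> {}"
  proof (rule compact_imp_fip_image[OF assms(1,2)])
    fix W assume W: "finite W" "W \<subseteq> V"
    show "K \<inter> (\<Inter>v\<in>W. G v) \<noteq> {}"
    proof (cases "W = {}")
      case True
      then show ?thesis using assms(3,4) by auto
    next
      case False
      then have "Min W \<in> V" using W Min_in by blast
      moreover have "G (Min W) \<subseteq> (\<Inter>v\<in>W. G v)" using W assms(5)[OF Min_le] by blast
      ultimately show ?thesis using assms(3) by blast
    qed
  qed
  then show ?thesis using that by blast
qed

lemma designs_enum: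
  assumes "Z \<in> designs X n" "X \<noteq> {}"
  obtains z where "\<And>i. z i \<in> X" "Z = z ` {..<n}" "inj_on z {..<n}"
proof -
  have "finite Z" "Z \<subseteq> X" "card Z = n" using assms by (auto simp: designs_def)
  then obtain h where h: "bij_betw h {..<n} Z"
    using ex_bij_betw_nat_finite[of Z] by (auto simp: atLeast0LessThan)
  obtain a where "a \<in> X" using assms by blast
  show ?thesis
  proof
    show "\<And>i. (if i < n then h i else a) \<in> X"
      using h \<open>a \<in> X\<close> \<open>Z \<subseteq> X\<close> by (auto simp: bij_betw_def)
    show "Z = (\<lambda>i. if i < n then h i else a) ` {..<n}" "inj_on (\<lambda>i. if i < n then h i else a) {..<n}"
      using h by (auto simp: bij_betw_def inj_on_def)
  qed
qed

lemma designs_superset: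
  assumes "infinite X" "Y \<subseteq> X" "finite Y" "card Y \<le> n"
  obtains Z where "Z \<in> designs X n" "Y \<subseteq> Z"
proof -
  have "infinite (X - Y)" using assms by simp
  then obtain B where B: "finite B" "card B = n - card Y" "B \<subseteq> X - Y"
    using infinite_arbitrarily_large by blast
  have "card (Y \<union> B) = card Y + card B" using B assms by (intro card_Un_disjoint) auto
  then have "Y \<union> B \<in> designs X n" using B assms by (auto simp: designs_def)
  then show ?thesis using that by blast
qed

text \<open>A minimising tuple may have repeated entries; padding it to \<open>n\<close> points only lowers the
  spacing.\<close>

lemma S_beta_attains_min:
  fixes X :: "(real^'d) set"
  assumes "compact X" "infinite X"
  shows "\<exists>Z\<in>designs X n. \<forall>W\<in>designs X n. S_beta \<beta> X Z \<le> S_beta \<beta> X W"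
proof -
  have ne: "X \<noteq> {}" using assms by auto
  define K where "K = {z :: nat \<Rightarrow> real^'d. \<forall>i. z i \<in> X}"
  define G where "G v = {z :: nat \<Rightarrow> real^'d.
    \<forall>x\<in>X. (\<exists>i\<in>{..<n}. norm (x - z i) \<le> v) \<or> \<beta> * dist_boundary X x \<le> v}" for v
  have G_iff: "z \<in> G v \<longleftrightarrow> S_beta \<beta> X (z ` {..<n}) \<le> v" for z v
    using assms ne by (simp add: G_def S_beta_le_iff D_beta_le_iff)
  have "compact K" unfolding K_def by (rule compact_tuples[OF assms(1)])
  moreover have "closed (G v)" for v
  proof -
    \<comment> \<open>For fixed \<open>x\<close> each condition is closed in the tuple, and the
      union over \<open>i\<close> is finite.\<close>
    have "G v = (\<Inter>x\<in>X. (\<Union>i\<in>{..<n}. {z. norm (x - z i) \<le> v}) \<union>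
        {z. \<beta> * dist_boundary X x \<le> v})"
      by (auto simp: G_def)
    also have "closed \<dots>"
      by (intro closed_INT ballI closed_Un closed_UN finite_lessThan closed_Collect_le
          continuous_intros continuous_on_product_coordinates)
    finally show ?thesis .
  qed
  moreover have "K \<inter> G v \<noteq> {}" if "v \<in> S_beta \<beta> X ` designs X n" for v
  proof -
    obtain Z where Z: "Z \<in> designs X n" "v = S_beta \<beta> X Z" using \<open>v \<in> _\<close> by blast
    obtain z where "\<And>i. z i \<in> X" "Z = z ` {..<n}" using designs_enum[OF Z(1) ne] by metis
    then have "z \<in> K \<inter> G v" using Z by (simp add: K_def G_iff)
    then show ?thesis by blast
  qed
  moreover have "S_beta \<beta> X ` designs X n \<noteq> {}"
    using designs_superset[OF assms(2), of "{}" n] by auto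
  moreover have "G v \<subseteq> G w" if "v \<le> w" for v w
    using that by (auto simp: G_iff)
  ultimately obtain z where z: "z \<in> K" "\<And>v. v \<in> S_beta \<beta> X ` designs X n \<Longrightarrow> z \<in> G v"
    using compact_Inter_nested[of K G "S_beta \<beta> X ` designs X n"] by metis
  obtain Z where Z: "Z \<in> designs X n" "z ` {..<n} \<subseteq> Z"
    using designs_superset[OF assms(2), of "z ` {..<n}" n] z(1) card_image_le[of "{..<n}" z]
    by (auto simp: K_def)
  have "S_beta \<beta> X Z \<le> S_beta \<beta> X (z ` {..<n})"
    using Z assms ne by (intro S_beta_antimono) (auto simp: designs_def)
  moreover have "S_beta \<beta> X (z ` {..<n}) \<le> S_beta \<beta> X W" if "W \<in> designs X n" for W
    using z(2)[of "S_beta \<beta> X W"] that by (simp add: G_iff)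
  ultimately show ?thesis using Z(1) order_trans by blast
qed

text \<open>A maximising tuple has distinct entries because its separation is positive.\<close>

lemma P_beta_attains_max:
  fixes X :: "(real^'d) set"
  assumes "compact X" "n \<ge> 2" "Y \<in> designs X n" "P_beta \<beta> X Y > 0"
  shows "\<exists>Z\<in>designs X n. \<forall>W\<in>designs X n. P_beta \<beta> X W \<le> P_beta \<beta> X Z"
proof -
  have "Y \<noteq> {}" "Y \<subseteq> X" using assms by (auto simp: designs_def)
  then have ne: "X \<noteq> {}" by auto
  define K where "K = {z :: nat \<Rightarrow> real^'d. \<forall>i. z i \<in> X}"
  \<comment> \<open>The sign of \<open>v\<close> turns maximisation into minimisation. The
    constraints range over indices, not points, which keeps \<open>G v\<close> closed even where
    entries coincide; on injective tuples the two readings agree.\<close>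
  define G where "G v = {z :: nat \<Rightarrow> real^'d.
    (\<forall>i\<in>{..<n}. \<forall>j\<in>{..<n}. i \<noteq> j \<longrightarrow> 2 * (- v) \<le> norm (z i - z j)) \<and>
    (\<forall>i\<in>{..<n}. 2 * (- v) \<le> \<beta> * dist_boundary X (z i))}" for v
  have G_iff: "z \<in> G v \<longleftrightarrow> - v \<le> P_beta \<beta> X (z ` {..<n})" if "inj_on z {..<n}" for z v
  proof -
    have "z \<in> G v \<longleftrightarrow> (\<forall>a\<in>z ` {..<n}. \<forall>b\<in>z ` {..<n}. a \<noteq> b \<longrightarrow> 2 * (- v) \<le> norm (a - b)) \<and>
    (\<forall>a\<in>z ` {..<n}. 2 * (- v) \<le> \<beta> * dist_boundary X a)"
      using inj_on_eq_iff[OF that] by (simp add: G_def)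
    then show ?thesis
      using le_P_beta_iff[of "z ` {..<n}" "- v" \<beta> X] assms(2) card_image[OF that] by simp
  qed
  let ?V = "(\<lambda>Z. - P_beta \<beta> X Z) ` designs X n"
  have "compact K" unfolding K_def by (rule compact_tuples[OF assms(1)])
  moreover have "closed (G v)" for v
  proof -
    have "G v = (\<Inter>i\<in>{..<n}. \<Inter>j\<in>{..<n}-{i}. {z. 2 * (- v) \<le> norm (z i - z j)}) \<inter>
      (\<Inter>i\<in>{..<n}. {z. 2 * (- v) \<le> \<beta> * dist_boundary X (z i)})"
      by (auto simp: G_def)
    also have "closed \<dots>"
      unfolding dist_boundary_def
      by (intro closed_INT ballI closed_Int closed_Collect_le
          continuous_intros continuous_on_product_coordinates)
    finally show ?thesis .
  qed
  moreover have "K \<inter> G v \<noteq> {}" if "v \<in> ?V" for v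
  proof -
    obtain Z where Z: "Z \<in> designs X n" "v = - P_beta \<beta> X Z" using \<open>v \<in> _\<close> by blast
    obtain z where "\<And>i. z i \<in> X" "Z = z ` {..<n}" "inj_on z {..<n}"
      using designs_enum[OF Z(1) ne] by metis
    then have "z \<in> K \<inter> G v" using Z by (simp add: K_def G_iff)
    then show ?thesis by blast
  qed
  moreover have "?V \<noteq> {}" using assms(3) by auto
  moreover have "G v \<subseteq> G w" if "v \<le> w" for v w
  proof -
    have "2 * (- w) \<le> 2 * (- v)" using that by simp
    then show ?thesis unfolding G_def by (blast intro: order_trans)
  qed
  ultimately obtain z where z: "z \<in> K" "\<And>v. v \<in> ?V \<Longrightarrow> z \<in> G v"
    using compact_Inter_nested[of K G ?V] by metis
  have "z \<in> G (- P_beta \<beta> X Y)" using z(2) assms(3) by blast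
  then have sep: "2 * P_beta \<beta> X Y \<le> norm (z i - z j)" if "i < n" "j < n" "i \<noteq> j" for i j
    using that by (simp add: G_def)
  have inj: "inj_on z {..<n}"
  proof (rule inj_onI, rule ccontr)
    fix i j assume "i \<in> {..<n}" "j \<in> {..<n}" "z i = z j" "i \<noteq> j"
    then show False using sep[of i j] assms(4) by simp
  qed
  have "z ` {..<n} \<in> designs X n"
    using z(1) card_image[OF inj] by (auto simp: designs_def K_def)
  moreover have "P_beta \<beta> X W \<le> P_beta \<beta> X (z ` {..<n})" if "W \<in> designs X n" for W
    using z(2)[of "- P_beta \<beta> X W"] that by (simp add: G_iff[OF inj])
  ultimately show ?thesis by blast
qed

text \<open>\<open>LEAST\<close> is specified only once a minimum exists, so every use of
  \<open>S_star\<close> goes through this fact.\<close>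

lemma S_star_attained:
  fixes X :: "(real^'d) set"
  assumes "compact X" "infinite X"
  shows "S_star \<beta> X n \<in> S_beta \<beta> X ` designs X n"
    and "W \<in> designs X n \<Longrightarrow> S_star \<beta> X n \<le> S_beta \<beta> X W"
proof -
  obtain Z where Z: "Z \<in> designs X n" "\<forall>W\<in>designs X n. S_beta \<beta> X Z \<le> S_beta \<beta> X W"
    using S_beta_attains_min[OF assms] by blast
  then have "S_star \<beta> X n = S_beta \<beta> X Z"
    unfolding S_star_def by (intro Least_equality) auto
  then show "S_star \<beta> X n \<in> S_beta \<beta> X ` designs X n"
    and "W \<in> designs X n \<Longrightarrow> S_star \<beta> X n \<le> S_beta \<beta> X W" using Z by auto
qed

text \<open>The design of positive \<open>P_beta\<close> will be the greedy one.\<close>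

lemma P_star_attained:
  fixes X :: "(real^'d) set"
  assumes "compact X" "n \<ge> 2" "Y \<in> designs X n" "P_beta \<beta> X Y > 0"
  shows "P_star \<beta> X n \<in> P_beta \<beta> X ` designs X n"
    and "W \<in> designs X n \<Longrightarrow> P_beta \<beta> X W \<le> P_star \<beta> X n"
proof -
  obtain Z where Z: "Z \<in> designs X n" "\<forall>W\<in>designs X n. P_beta \<beta> X W \<le> P_beta \<beta> X Z"
    using P_beta_attains_max[OF assms] by blast
  then have "P_star \<beta> X n = P_beta \<beta> X Z"
    unfolding P_star_def by (intro Greatest_equality) auto
  then show "P_star \<beta> X n \<in> P_beta \<beta> X ` designs X n"
    and "W \<in> designs X n \<Longrightarrow> P_beta \<beta> X W \<le> P_star \<beta> X n" using Z by auto
qed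

section \<open>The greedy sequence\<close>

lemma greedy_seq_S_beta:
  assumes "compact X" "greedy_seq \<beta> X x"
  shows "x (Suc k) \<in> X" and "S_beta \<beta> X (x ` {1..k}) = D_beta \<beta> X (x (Suc k)) (x ` {1..k})"
proof -
  have m: "x (Suc k) \<in> X"
    "\<And>y. y \<in> X \<Longrightarrow> D_beta \<beta> X y (x ` {1..k}) \<le> D_beta \<beta> X (x (Suc k)) (x ` {1..k})"
    using assms(2) by (auto simp: greedy_seq_def is_arg_max_linorder)
  then show "x (Suc k) \<in> X" by simp
  have "X \<noteq> {}" using m(1) by blast
  then show "S_beta \<beta> X (x ` {1..k}) = D_beta \<beta> X (x (Suc k)) (x ` {1..k})"
    using m D_beta_le_S_beta[OF assms(1) _ m(1)] S_beta_le_iff[OF assms(1)]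
    by (intro antisym) auto
qed

text \<open>When \<open>x i\<close> is chosen, its \<open>D_beta\<close> equals the spacing of its
  predecessors. These lie among the first \<open>n\<close> points, even for
  \<open>i = n + 1\<close>, and so have at least the spacing of those.\<close>

lemma greedy_seq_separation:
  assumes "compact X" "greedy_seq \<beta> X x" "i \<in> {1..n+1}"
  shows "S_beta \<beta> X (x ` {1..n}) \<le> \<beta> * dist_boundary X (x i)"
    and "1 \<le> j \<Longrightarrow> j < i \<Longrightarrow> S_beta \<beta> X (x ` {1..n}) \<le> norm (x i - x j)"
proof -
  obtain k where k: "i = Suc k" "k \<le> n" using assms(3) by (cases i) auto
  have "X \<noteq> {}" using greedy_seq_S_beta(1)[OF assms(1,2)] by blast
  then have "S_beta \<beta> X (x ` {1..n}) \<le> S_beta \<beta> X (x ` {1..k})"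
    using k assms(1) by (intro S_beta_antimono) auto
  also have "\<dots> = D_beta \<beta> X (x i) (x ` {1..k})"
    using greedy_seq_S_beta(2)[OF assms(1,2)] k by simp
  finally have "S_beta \<beta> X (x ` {1..n}) \<le> D_beta \<beta> X (x i) (x ` {1..k})" .
  then have D: "\<forall>z\<in>x ` {1..k}. S_beta \<beta> X (x ` {1..n}) \<le> norm (x i - z)"
    "S_beta \<beta> X (x ` {1..n}) \<le> \<beta> * dist_boundary X (x i)"
    by (simp_all add: le_D_beta_iff)
  show "S_beta \<beta> X (x ` {1..n}) \<le> \<beta> * dist_boundary X (x i)" by (fact D(2))
  show "S_beta \<beta> X (x ` {1..n}) \<le> norm (x i - x j)" if "1 \<le> j" "j < i"
    using D(1) that k by auto
qed

lemma greedy_seq_designs: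
  assumes "compact X" "interior X \<noteq> {}" "\<beta> > 0" "greedy_seq \<beta> X x"
  shows "x ` {1..n} \<in> designs X n"
proof -
  have pos: "0 < S_beta \<beta> X (x ` {1..n})" using assms by (intro S_beta_pos) auto
  have "x i \<noteq> x j" if "i \<in> {1..n}" "j \<in> {1..n}" "j < i" for i j
    using greedy_seq_separation(2)[OF assms(1,4), of i n j] that pos by auto
  then have "inj_on x {1..n}"
    by (metis inj_onI linorder_neqE_nat)
  moreover have "x i \<in> X" if "i \<in> {1..n}" for i
    using greedy_seq_S_beta(1)[OF assms(1,4), of "i - 1"] that by simp
  ultimately show ?thesis by (auto simp: designs_def card_image)
qed

lemma greedy_seq_P_beta:
  assumes "compact X" "interior X \<noteq> {}" "\<beta> > 0" "greedy_seq \<beta> X x" "n \<ge> 1"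
  shows "P_beta \<beta> X (x ` {1..n+1}) = 1/2 * S_beta \<beta> X (x ` {1..n})"
proof -
  let ?Y = "x ` {1..n+1}" and ?s = "S_beta \<beta> X (x ` {1..n})"
  have card: "card ?Y = n + 1" "card (x ` {1..n}) = n"
    using greedy_seq_designs[OF assms(1-4)] by (auto simp: designs_def)
  have Y: "finite ?Y" "card ?Y \<ge> 2" using card assms(5) by auto
  have "?s \<le> norm (x i - x j)" if "i \<in> {1..n+1}" "j \<in> {1..n+1}" "x i \<noteq> x j" for i j
  proof (cases "j < i")
    case True
    then show ?thesis using greedy_seq_separation(2)[OF assms(1,4)] that by auto
  next
    case False
    then have "i < j" using that by (metis linorder_neqE_nat)
    then show ?thesis
      using greedy_seq_separation(2)[OF assms(1,4), of j n i] that by (simp add: norm_minus_commute)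
  qed
  then have ge: "1/2 * ?s \<le> P_beta \<beta> X ?Y"
    unfolding le_P_beta_iff[OF Y] using greedy_seq_separation(1)[OF assms(1,4)] by auto
  let ?p = "P_beta \<beta> X ?Y"
  have P: "\<forall>z\<in>?Y. \<forall>w\<in>?Y. z \<noteq> w \<longrightarrow> 2 * ?p \<le> norm (z - w)"
    "\<forall>z\<in>?Y. 2 * ?p \<le> \<beta> * dist_boundary X z"
    using le_P_beta_iff[OF Y, of ?p \<beta> X] by auto
  have last: "x (Suc n) \<in> ?Y" "x ` {1..n} \<subseteq> ?Y" by auto
  \<comment> \<open>Separation in \<open>P_beta\<close> concerns distinct points only, so the last
    point must be new before its distances to the others can be bounded below.\<close>
  have "x (Suc n) \<notin> x ` {1..n}"
  proof
    assume "x (Suc n) \<in> x ` {1..n}"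
    moreover have "?Y = insert (x (Suc n)) (x ` {1..n})" by (simp add: atLeastAtMostSuc_conv)
    ultimately have "?Y = x ` {1..n}" by (simp add: insert_absorb)
    then show False using card by simp
  qed
  then have "2 * ?p \<le> D_beta \<beta> X (x (Suc n)) (x ` {1..n})"
    using P last by (subst le_D_beta_iff) (simp, metis subsetD)
  also have "\<dots> = ?s" using greedy_seq_S_beta(2)[OF assms(1,4)] by simp
  finally show ?thesis using ge by simp
qed

theorem theorem2:
  fixes X :: "(real^'d) set" and \<beta> :: real and x :: "nat \<Rightarrow> real^'d"
  assumes "compact X" and "convex X" and "interior X \<noteq> {}"
    and "\<beta> > 0"
    and "greedy_seq \<beta> X x"
  shows "(\<forall>n\<ge>1. P_beta \<beta> X (x ` {1..n+1}) = 1/2 * S_beta \<beta> X (x ` {1..n})) \<and>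
    (\<forall>n\<ge>1. 1/2 \<le> S_star \<beta> X n / S_beta \<beta> X (x ` {1..n}) \<and>
            S_star \<beta> X n / S_beta \<beta> X (x ` {1..n}) \<le> 1) \<and>
    (\<forall>n\<ge>2. 1/2 \<le> P_beta \<beta> X (x ` {1..n}) / P_star \<beta> X n \<and>
            P_beta \<beta> X (x ` {1..n}) / P_star \<beta> X n \<le> 1) \<and>
    (\<forall>n\<ge>2. 1 \<le> rho_beta \<beta> X (x ` {1..n}) \<and> rho_beta \<beta> X (x ` {1..n}) \<le> 2)"
proof -
  let ?X = "\<lambda>n. x ` {1..n}"
  have P: "P_beta \<beta> X (?X (n+1)) = 1/2 * S_beta \<beta> X (?X n)" if "n \<ge> 1" for n
    using greedy_seq_P_beta assms that by blast
  have S_pos: "0 < S_beta \<beta> X (?X n)" for n using assms by (intro S_beta_pos) auto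
  have des: "?X n \<in> designs X n" for n using greedy_seq_designs assms by blast
  have inf: "infinite X" using assms(3) empty_interior_finite by blast
  have S: "1/2 * S_beta \<beta> X (?X n) \<le> S_star \<beta> X n \<and> S_star \<beta> X n \<le> S_beta \<beta> X (?X n)"
    if n: "n \<ge> 1" for n
  proof
    obtain Z where Z: "Z \<in> designs X n" "S_star \<beta> X n = S_beta \<beta> X Z"
      using S_star_attained(1)[OF assms(1) inf] by blast
    \<comment> \<open>One extra greedy point triggers the pigeonhole bound against the optimal
      \<open>n\<close>-point design.\<close>
    have "P_beta \<beta> X (?X (n+1)) \<le> S_beta \<beta> X Z"
      using Z(1) des[of "n+1"] assms n
      by (intro P_beta_le_S_beta_if_card_less) (auto simp: designs_def)
    then show "1/2 * S_beta \<beta> X (?X n) \<le> S_star \<beta> X n" using P[OF n] Z(2) by simp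
  qed (rule S_star_attained(2)[OF assms(1) inf des])
  have Pn: "P_beta \<beta> X (?X n) = 1/2 * S_beta \<beta> X (?X (n - 1))" if "n \<ge> 2" for n
    using P[of "n - 1"] that by simp
  have P_pos: "0 < P_beta \<beta> X (?X n)" if "n \<ge> 2" for n
    using Pn[OF that] S_pos[of "n - 1"] by simp
  have Ps: "1/2 * P_star \<beta> X n \<le> P_beta \<beta> X (?X n) \<and> P_beta \<beta> X (?X n) \<le> P_star \<beta> X n"
    if n: "n \<ge> 2" for n
  proof
    note star = P_star_attained[OF assms(1) n des P_pos[OF n]]
    obtain Y where Y: "Y \<in> designs X n" "P_star \<beta> X n = P_beta \<beta> X Y" using star(1) by blast
    \<comment> \<open>Here the optimal design is the larger one; the greedy design has one point
      fewer and is nonempty because \<open>n\<close> is at least 2.\<close>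
    have "P_beta \<beta> X Y \<le> S_beta \<beta> X (?X (n - 1))"
      using Y(1) des[of "n - 1"] assms n
      by (intro P_beta_le_S_beta_if_card_less) (auto simp: designs_def)
    then show "1/2 * P_star \<beta> X n \<le> P_beta \<beta> X (?X n)" using Pn[OF n] Y(2) by simp
    show "P_beta \<beta> X (?X n) \<le> P_star \<beta> X n" by (rule star(2)[OF des])
  qed
  have R: "P_beta \<beta> X (?X n) \<le> S_beta \<beta> X (?X n) \<and> S_beta \<beta> X (?X n) \<le> 2 * P_beta \<beta> X (?X n)"
    if n: "n \<ge> 2" for n
  proof
    show "P_beta \<beta> X (?X n) \<le> S_beta \<beta> X (?X n)"
      using assms des[of n] n P_pos[OF n] by (intro P_beta_le_S_beta) (auto simp: designs_def)
    have "S_beta \<beta> X (?X n) \<le> S_beta \<beta> X (?X (n - 1))"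
      using assms(1) inf by (intro S_beta_antimono) auto
    then show "S_beta \<beta> X (?X n) \<le> 2 * P_beta \<beta> X (?X n)" using Pn[OF n] by simp
  qed
  have "1/2 \<le> S_star \<beta> X n / S_beta \<beta> X (?X n) \<and> S_star \<beta> X n / S_beta \<beta> X (?X n) \<le> 1"
    if "n \<ge> 1" for n
    using S[OF that] S_pos[of n] by (simp add: field_simps)
  moreover have "1/2 \<le> P_beta \<beta> X (?X n) / P_star \<beta> X n \<and> P_beta \<beta> X (?X n) / P_star \<beta> X n \<le> 1"
    if n: "n \<ge> 2" for n
  proof -
    have "0 < P_star \<beta> X n" using Ps[OF n] P_pos[OF n] by linarith
    then show ?thesis using Ps[OF n] by (simp add: field_simps)
  qed
  moreover have "1 \<le> rho_beta \<beta> X (?X n) \<and> rho_beta \<beta> X (?X n) \<le> 2" if "n \<ge> 2" for n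
    using R[OF that] P_pos[OF that] by (simp add: rho_beta_def field_simps)
  ultimately show ?thesis using P by blast
qed

end
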